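(* Let $B$ be a polynomial with complex coefficients of degree at least two. Then a polynomial $X$ of degree at least two is contained in $\mathcal{E}(B)$ if and only if $K(B)$ is a union of fibers of $X$, i.e. $K(B)=X^{-1}(X(K(B)))$. In particular, if $B_1$ and $B_2$ are polynomials of degree at least two such that $K(B_1)=K(B_2)$, then $\mathcal{E}(B_1)=\mathcal{E}(B_2)$.
   Context: For a polynomial $B$ of degree at least two, $K(B)$ denotes its filled-in Julia set (the set of points of $\mathbb{C}$ with bounded orbit under iteration of $B$), and $\mathcal{E}(B)$ denotes the set of polynomials $X\in\mathbb{C}[z]$ of degree at least two for which there exists a polynomial $A$ with $A\circ X=X\circ B$. *)

theory Defs
  imports "HOL-Analysis.Analysis" "HOL-Computational_Algebra.Polynomial"
begin

definition filled_julia :: "complex poly \<Rightarrow> complex set"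
  where "filled_julia B = {z. bounded (range (\<lambda>n. (poly B ^^ n) z))}"

text \<open>\<^term>\<open>pcompose p q\<close> is \<open>p \<circ> q\<close>, so the equation below reads
  \<open>A \<circ> X = X \<circ> B\<close>.\<close>

definition semiconj_set :: "complex poly \<Rightarrow> complex poly set"
  where "semiconj_set B = {X. degree X \<ge> 2 \<and> (\<exists>A. pcompose A X = pcompose X B)}"

end

theory Submission
  imports Defs "HOL-Computational_Algebra.Fundamental_Theorem_Algebra"
begin

text \<open>Write \<open>K = K(B)\<close>. A semiconjugacy \<open>A \<circ> X = X \<circ> B\<close> carries over to iterates, so two points in one fibre of
\<open>X\<close> have both bounded or both unbounded orbits; this is the easy direction
(\<open>semiconjugacy_imp_saturated\<close>).

For the converse, suppose that \<open>K\<close> is a union of fibres of \<open>X\<close>. Since \<open>K\<close> is its own preimage under \<open>B\<close>,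
it is also a union of fibres of \<open>X \<circ> B\<close>. The heart of the proof is the lemma \<open>saturated_imp_factor\<close>: if an
infinite compact set is a union of fibres of \<open>f\<close> and of \<open>g\<close>, and \<open>degree f\<close> divides \<open>degree g\<close>, then
\<open>g = A \<circ> f\<close> for a polynomial \<open>A\<close>. Taking \<open>f = X\<close> and \<open>g = X \<circ> B\<close> gives the required \<open>A\<close>.

The lemma rests on polynomials of least deviation from zero. Among the polynomials with a given leading
term, at most one has the smallest sup norm on an infinite compact set
(\<open>minimal_deviation_unique\<close>). On the other hand, averaging a polynomial over the fibres of \<open>f\<close> yields a
polynomial in \<open>f\<close>, because Newton's identities express the power sums of the roots of \<open>f - w\<close> of order
below \<open>degree f\<close> without \<open>w\<close> (\<open>fibre_average_poly\<close>). When fibres do not leave \<open>K\<close>, averaging cannot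
increase the norm on \<open>K\<close>. Averaging over the fibres of \<open>g\<close> shows that \<open>g - c\<close> has least deviation on \<open>K\<close>,
where \<open>c\<close> is the centre of the smallest disc around \<open>g(K)\<close>; averaging \<open>g - c\<close> over the fibres of \<open>f\<close>
produces another polynomial of least deviation. The two must be equal, so \<open>g - c\<close> is a
polynomial in \<open>f\<close>.

The second claim follows from the first, as the criterion mentions \<open>B\<close> only through \<open>K(B)\<close>.\<close>

section \<open>Averages over the fibres of a polynomial\<close>

text \<open>The sum runs over the multiset of roots of \<open>f - w\<close>, so that each point of the fibre counts with its
multiplicity and every fibre has exactly \<open>degree f\<close> points, also over the critical values.\<close>

definition fibre_sum :: "complex poly \<Rightarrow> complex poly \<Rightarrow> complex \<Rightarrow> complex"
  where "fibre_sum f p w = (\<Sum>x\<in>#proots (f - [:w:]). poly p x)"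

lemma degree_diff_const:
  fixes f :: "complex poly"
  shows "degree (f - [:w:]) = degree f"
  by (cases f) (simp add: degree_pCons_eq_if)

lemma diff_const_nonzero:
  fixes f :: "complex poly"
  assumes "0 < degree f"
  shows "f - [:w:] \<noteq> 0"
  using assms by auto

lemma set_fibre:
  fixes f :: "complex poly"
  assumes "0 < degree f"
  shows "set_mset (proots (f - [:w:])) = {x. poly f x = w}"
  using diff_const_nonzero[OF assms] by auto

lemma size_fibre:
  fixes f :: "complex poly"
  shows "size (proots (f - [:w:])) = degree f"
  by (simp add: size_proots_complex degree_diff_const)

lemma poly_surj:
  fixes f :: "complex poly"
  assumes "0 < degree f"
  shows "\<exists>z. poly f z = w"
proof -
  have "proots (f - [:w:]) \<noteq> {#}"
    using size_fibre[of f w] assms by auto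
  then show ?thesis using set_fibre[OF assms, of w] by auto
qed

lemma fibre_sum_add: "fibre_sum f (p + q) w = fibre_sum f p w + fibre_sum f q w"
  by (simp add: fibre_sum_def sum_mset.distrib)

lemma fibre_sum_smult: "fibre_sum f (smult c p) w = c * fibre_sum f p w"
  by (simp add: fibre_sum_def sum_mset_distrib_left)

lemma fibre_sum_const: "fibre_sum f [:c:] w = of_nat (degree f) * c"
  using size_fibre[of f w] by (simp add: fibre_sum_def)

text \<open>A factor that is a polynomial in \<open>f\<close> is constant on the fibre and leaves the sum as a scalar.\<close>

lemma fibre_sum_pcompose_mult:
  assumes "0 < degree f"
  shows "fibre_sum f (pcompose q f * p) w = poly q w * fibre_sum f p w"
proof -
  have "fibre_sum f (pcompose q f * p) w = (\<Sum>x\<in>#proots (f - [:w:]). poly q w * poly p x)"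
    unfolding fibre_sum_def
    by (intro arg_cong[where f = sum_mset] image_mset_cong)
       (use set_fibre[OF assms, of w] in \<open>auto simp: poly_pcompose\<close>)
  then show ?thesis by (simp add: fibre_sum_def sum_mset_distrib_left)
qed

lemma norm_sum_mset_le:
  fixes h :: "'a \<Rightarrow> complex"
  assumes "\<And>x. x \<in># M \<Longrightarrow> norm (h x) \<le> \<mu>"
  shows "norm (\<Sum>x\<in>#M. h x) \<le> of_nat (size M) * \<mu>"
  using assms
proof (induction M)
  case (add x M)
  have "norm (h x + (\<Sum>x\<in>#M. h x)) \<le> \<mu> + of_nat (size M) * \<mu>"
    by (intro norm_triangle_le add_mono) (use add in auto)
  then show ?case by (simp add: algebra_simps)
qed simp

text \<open>An average is bounded by any bound for its terms; \<open>v\<close> is the average of \<open>p\<close> over the fibre.\<close>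

lemma norm_fibre_average_le:
  assumes "0 < degree f" and "fibre_sum f p w = of_nat (degree f) * v"
    and "\<And>x. poly f x = w \<Longrightarrow> norm (poly p x) \<le> \<mu>"
  shows "norm v \<le> \<mu>"
proof -
  have "norm (fibre_sum f p w) \<le> of_nat (size (proots (f - [:w:]))) * \<mu>"
    unfolding fibre_sum_def
    by (rule norm_sum_mset_le) (use set_fibre[OF assms(1), of w] assms(3) in auto)
  then show ?thesis
    using assms(1,2) size_fibre[of f w] by (simp add: norm_mult)
qed

lemma coeff_synthetic_div: "coeff (synthetic_div p x) k = poly (poly_shift (Suc k) p) x"
proof (induction p arbitrary: k)
  case (pCons a p)
  have "poly_shift (Suc k) (pCons a p) = poly_shift k p" for k
    by (simp add: poly_eq_iff coeff_poly_shift)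
  then show ?case using pCons by (cases k) auto
qed simp

text \<open>This is the logarithmic derivative \<open>P'/P = \<Sum> 1/(z - x)\<close> over the roots \<open>x\<close> of \<open>P\<close>, multiplied by \<open>P\<close>:
synthetic division by the root \<open>x\<close> computes \<open>P/(z - x)\<close>.\<close>

lemma pderiv_eq_sum_synthetic_div:
  fixes c :: "'a :: idom"
  defines "P \<equiv> \<lambda>A. smult c (\<Prod>x\<in>#A. [:-x, 1:])"
  shows "pderiv (P A) = (\<Sum>x\<in>#A. synthetic_div (P A) x)"
proof (induction A)
  case empty
  then show ?case by (simp add: P_def)
next
  case (add a A)
  have step: "P (add_mset a A) = [:-a, 1:] * P A" by (simp add: P_def)
  have root: "[:-x, 1:] * synthetic_div p x = p" if "poly p x = 0" for x and p :: "'a poly"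
    using synthetic_div_correct'[of x p] that by simp
  have "synthetic_div (P (add_mset a A)) x = [:-a, 1:] * synthetic_div (P A) x" if "x \<in># A" for x
  proof -
    have x: "poly (P A) x = 0"
      using that unfolding P_def by (induction A) auto
    have "[:-x, 1:] * synthetic_div (P (add_mset a A)) x = [:-a, 1:] * P A"
      using root[of "P (add_mset a A)" x] x by (simp only: step poly_mult mult_zero_right)
    also have "\<dots> = [:-x, 1:] * ([:-a, 1:] * synthetic_div (P A) x)"
      by (subst (1) root[OF x, symmetric]) (rule mult.left_commute)
    finally show ?thesis by (subst (asm) mult_left_cancel) auto
  qed
  moreover have "synthetic_div (P (add_mset a A)) a = P A"
  proof -
    have "[:-a, 1:] * synthetic_div (P (add_mset a A)) a = [:-a, 1:] * P A"
      using root[of "P (add_mset a A)" a] by (simp only: step poly_mult) simp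
    then show ?thesis by (subst (asm) mult_left_cancel) auto
  qed
  ultimately have "(\<Sum>x\<in>#add_mset a A. synthetic_div (P (add_mset a A)) x)
      = P A + (\<Sum>x\<in>#A. [:-a, 1:] * synthetic_div (P A) x)"
    by (simp cong: image_mset_cong)
  also have "\<dots> = P A + [:-a, 1:] * pderiv (P A)"
    using add by (simp add: sum_mset_distrib_left)
  also have "\<dots> = pderiv (P (add_mset a A))"
    unfolding step by (simp add: pderiv_diff pderiv_smult pderiv_pCons)
  finally show ?case by simp
qed

text \<open>The quotient \<open>(f - w)/(z - x)\<close> at a root \<open>x\<close> of \<open>f - w\<close> is the synthetic division of \<open>f\<close> by \<open>x\<close>, which
never reads the constant coefficient and hence does not see \<open>w\<close>. Its coefficients are the values at
\<open>x\<close> of the polynomials obtained from \<open>f\<close> by dropping low coefficients. Summing over the fibre gives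
\<open>f'\<close>, which is independent of \<open>w\<close>. Comparing coefficients yields Newton's identities for the power sums of
the roots of \<open>f - w\<close>, in a form that needs no recursion.\<close>

lemma fibre_sum_poly_shift:
  assumes "0 < degree f"
  shows "fibre_sum f (poly_shift (Suc k) f) w = coeff (pderiv f) k"
proof -
  have sd: "synthetic_div (f - [:w:]) x = synthetic_div f x" for x
    by (cases f) simp
  have "pderiv (f - [:w:]) = (\<Sum>x\<in>#proots (f - [:w:]). synthetic_div (f - [:w:]) x)"
    using pderiv_eq_sum_synthetic_div[of "lead_coeff (f - [:w:])" "proots (f - [:w:])"]
    by (simp only: complex_poly_decompose_multiset)
  then have eq: "pderiv f = (\<Sum>x\<in>#proots (f - [:w:]). synthetic_div f x)"
    by (simp add: sd pderiv_diff)
  have "coeff (\<Sum>x\<in>#M. synthetic_div f x) k = (\<Sum>x\<in>#M. coeff (synthetic_div f x) k)" for M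
    by (induction M) auto
  then show ?thesis
    unfolding eq by (simp add: fibre_sum_def coeff_synthetic_div)
qed

text \<open>Dropping the lowest \<open>k\<close> coefficients of \<open>f\<close>, for \<open>1 \<le> k \<le> degree f\<close>, leaves one polynomial
of each degree below \<open>degree f\<close>. These polynomials span everything of lower degree, and each of them
has a constant fibre sum.\<close>

lemma fibre_sum_lower_degree_const:
  assumes "degree p < degree f"
  shows "\<exists>c. \<forall>w. fibre_sum f p w = c"
  using assms
proof (induction "degree p" arbitrary: p rule: less_induct)
  case less
  then have f: "0 < degree f" by simp
  show ?case
  proof (cases "degree p = 0")
    case True
    then obtain c where "p = [:c:]" by (auto elim: degree_eq_zeroE)
    then show ?thesis using fibre_sum_const[of f] by auto
  next
    case False
    \<comment> \<open>\<open>s\<close> has the degree of \<open>p\<close>, so a multiple of it cancels the leading term of \<open>p\<close>.\<close>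
    define s where "s = poly_shift (degree f - degree p) f"
    define a where "a = lead_coeff p / lead_coeff f"
    define r where "r = p - smult a s"
    have coeff_s: "coeff s i = coeff f (i + (degree f - degree p))" for i
      by (simp add: s_def coeff_poly_shift)
    have "degree r < degree p"
    proof (rule degree_lessI)
      show "r \<noteq> 0 \<or> 0 < degree p" using False by simp
      show "\<forall>k\<ge>degree p. coeff r k = 0"
      proof (intro allI impI)
        fix k assume k: "degree p \<le> k"
        show "coeff r k = 0"
        proof (cases "k = degree p")
          case True
          then show ?thesis using less.prems f by (auto simp: r_def coeff_s a_def)
        next
          case False
          then have "degree p < k" "degree f < k + (degree f - degree p)"
            using k less.prems by auto
          then show ?thesis by (simp add: r_def coeff_s coeff_eq_0)
        qed
      qed
    qed
    with less obtain c where c: "\<And>w. fibre_sum f r w = c" by (metis less_trans)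
    have "\<exists>k. s = poly_shift (Suc k) f"
      using less.prems unfolding s_def by (metis Suc_diff_Suc)
    then obtain k where k: "s = poly_shift (Suc k) f" by blast
    have "fibre_sum f p w = c + a * coeff (pderiv f) k" for w
    proof -
      have "fibre_sum f p w = fibre_sum f (r + smult a s) w" by (simp add: r_def)
      then show ?thesis
        by (simp only: fibre_sum_add fibre_sum_smult c k fibre_sum_poly_shift[OF f])
    qed
    then show ?thesis by blast
  qed
qed

text \<open>Writing \<open>p = r\<^sub>0 + r\<^sub>1 f + r\<^sub>2 f\<^sup>2 + \<dots>\<close> with digits of degree below \<open>degree f\<close>, each
digit averages to a constant and each power of \<open>f\<close> to a power of \<open>w\<close>. The average of \<open>p\<close> over
the fibre is therefore a polynomial in \<open>w\<close>, with at most one power of \<open>w\<close> for every \<open>degree f\<close> powers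
of \<open>z\<close>. The degree bound makes averaging preserve the leading term in the main argument.\<close>

lemma fibre_average_poly:
  assumes f: "0 < degree f"
  shows "\<exists>q. degree q * degree f \<le> degree p \<and>
    (\<forall>w. fibre_sum f p w = of_nat (degree f) * poly q w)"
proof (induction "degree p" arbitrary: p rule: less_induct)
  case less
  show ?case
  proof (cases "degree p < degree f")
    case True
    then obtain c where c: "\<And>w. fibre_sum f p w = c"
      using fibre_sum_lower_degree_const by blast
    show ?thesis
      by (rule exI[of _ "[:c / of_nat (degree f):]"]) (use f c in simp)
  next
    case False
    define p' where "p' = p div f"
    have mod: "degree (p mod f) < degree f"
      using f degree_mod_less[of f p] by force
    have p': "degree p' + degree f = degree p"
    proof -
      have split: "p = p' * f + p mod f" by (simp add: p'_def)
      then have "p' \<noteq> 0" using mod False by auto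
      then have "degree (p' * f) = degree p' + degree f"
        using f by (intro degree_mult_eq) auto
      moreover have "degree (p' * f + p mod f) = degree (p' * f)"
        using mod calculation by (intro degree_add_eq_left) simp
      ultimately show ?thesis using split by simp
    qed
    from mod obtain c where c: "\<And>w. fibre_sum f (p mod f) w = c"
      using fibre_sum_lower_degree_const by blast
    obtain q where q: "degree q * degree f \<le> degree p'"
        "\<And>w. fibre_sum f p' w = of_nat (degree f) * poly q w"
      using less[of p'] p' f by auto
    have "fibre_sum f p w = of_nat (degree f) * poly (pCons (c / of_nat (degree f)) q) w" for w
    proof -
      have "fibre_sum f p w = fibre_sum f (p mod f + pcompose [:0, 1:] f * p') w"
        by (simp add: p'_def pcompose_pCons)
      also have "\<dots> = c + w * fibre_sum f p' w"
        by (simp only: fibre_sum_add c fibre_sum_pcompose_mult[OF f]) simp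
      finally show ?thesis using f q(2) by (simp add: algebra_simps)
    qed
    moreover have "degree (pCons (c / of_nat (degree f)) q) * degree f \<le> degree p"
      using q(1) p' False by (simp add: degree_pCons_eq_if)
    ultimately show ?thesis by blast
  qed
qed

section \<open>Polynomials of least deviation from zero\<close>

text \<open>Uniqueness of the Chebyshev polynomial: \<open>\<mu>\<close> is the least sup norm on \<open>K\<close> attained by a polynomial with
the leading term of \<open>G\<close>, and both \<open>G\<close> and \<open>H\<close> attain it. Their midpoint \<open>M\<close> does so as well, and where
\<open>M\<close> has modulus \<open>\<mu>\<close>, strict convexity of the disc forces \<open>G\<close> and \<open>H\<close> to agree. The extremal
points of \<open>M\<close> are thus zeros of \<open>D = G - H\<close>, so the remainder \<open>r\<close> of \<open>M\<close> modulo \<open>D\<close> equals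
\<open>M\<close> at all of them. Since \<open>r\<close> has lower degree, subtracting a small multiple of it from \<open>M\<close>
is an admissible change, and it pushes the norm strictly below \<open>\<mu>\<close>.\<close>

lemma minimal_deviation_unique:
  fixes G H :: "complex poly"
  assumes K: "compact K" "infinite K"
    and G: "\<And>z. z \<in> K \<Longrightarrow> norm (poly G z) \<le> \<mu>"
    and H: "\<And>z. z \<in> K \<Longrightarrow> norm (poly H z) \<le> \<mu>"
    and deg: "degree (G - H) < degree G"
    and minimal: "\<And>r. degree r < degree G \<Longrightarrow> \<exists>z\<in>K. \<mu> \<le> norm (poly (G + r) z)"
  shows "G = H"
proof (rule ccontr)
  assume "G \<noteq> H"
  define D where "D = G - H"
  define M where "M = G - smult (1/2) D"
  define r where "r = M mod D"
  have "D \<noteq> 0" using \<open>G \<noteq> H\<close> by (simp add: D_def)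
  have poly_M: "poly M z = (poly G z + poly H z) / 2" for z
    by (simp add: M_def D_def field_simps)
  have M_le: "norm (poly M z) \<le> \<mu>" if "z \<in> K" for z
    using norm_triangle_ineq[of "poly G z" "poly H z"] G[OF that] H[OF that]
    by (simp add: poly_M norm_divide)
  have extremal: "poly r z = poly M z" if "z \<in> K" "norm (poly M z) = \<mu>" for z
  proof -
    have "poly G z = poly H z"
    proof (rule ccontr)
      assume ne: "poly G z \<noteq> poly H z"
      have sum: "norm (poly G z + poly H z) = 2 * \<mu>"
        using that(2) by (simp add: poly_M norm_divide)
      \<comment> \<open>The parallelogram law; the first term on the left is already \<open>4 \<mu>\<^sup>2\<close>.\<close>
      have "(norm (poly G z + poly H z))\<^sup>2 + (norm (poly G z - poly H z))\<^sup>2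
          = 2 * (norm (poly G z))\<^sup>2 + 2 * (norm (poly H z))\<^sup>2"
        by (simp add: power2_norm_eq_inner algebra_simps inner_commute)
      moreover have "(norm (poly G z))\<^sup>2 \<le> \<mu>\<^sup>2" "(norm (poly H z))\<^sup>2 \<le> \<mu>\<^sup>2"
        using G[OF that(1)] H[OF that(1)] by (auto intro: power_mono)
      ultimately have "(norm (poly G z - poly H z))\<^sup>2 \<le> 0"
        unfolding sum power_mult_distrib power2_eq_square[of 2] by linarith
      then show False using ne by simp
    qed
    then have "poly D z = 0" by (simp add: D_def)
    then have "poly (M div D * D + M mod D) z = poly r z"
      by (simp only: poly_add poly_mult r_def) simp
    then show ?thesis by (simp only: div_mult_mod_eq)
  qed
  have deg_D: "degree D < degree G" using deg by (simp add: D_def)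
  have deg_r: "degree r < degree G"
    using degree_mod_less[OF \<open>D \<noteq> 0\<close>, of M] deg_D by (auto simp: r_def)
  have M_minimal: "\<exists>z\<in>K. \<mu> \<le> norm (poly (M - smult (of_real \<epsilon>) r) z)" for \<epsilon> :: real
  proof -
    have "degree (- smult (1/2) D - smult (of_real \<epsilon>) r) < degree G"
      using deg_D deg_r by (intro degree_diff_less) (auto intro: le_less_trans[OF degree_smult_le])
    from minimal[OF this] show ?thesis by (simp add: M_def algebra_simps)
  qed
  \<comment> \<open>This is where \<open>K\<close> must be infinite: on a finite \<open>K\<close> a nonzero \<open>G\<close> may vanish identically.\<close>
  have "\<mu> > 0"
  proof (rule ccontr)
    assume "\<not> \<mu> > 0"
    have "K \<subseteq> {z. poly G z = 0}"
    proof
      fix z assume "z \<in> K"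
      then have "norm (poly G z) \<le> 0" using G[of z] \<open>\<not> \<mu> > 0\<close> by linarith
      then show "z \<in> {z. poly G z = 0}" by simp
    qed
    moreover have "G \<noteq> 0" using deg by auto
    ultimately show False using K(2) poly_roots_finite finite_subset by blast
  qed
  \<comment> \<open>Outside \<open>U\<close> the remainder \<open>r\<close> is close enough to \<open>M\<close> for \<open>(1 - \<epsilon>) M + \<epsilon> (M - r)\<close> to be shorter
    than \<open>\<mu>\<close>, for every \<open>\<epsilon>\<close> in \<open>(0,1]\<close>. The compact set \<open>U\<close> contains no extremal point, so on it \<open>M\<close>
    leaves a gap below \<open>\<mu>\<close> that absorbs \<open>\<epsilon> r\<close> for small \<open>\<epsilon>\<close>.\<close>
  define U where "U = {z \<in> K. \<mu> / 2 \<le> norm (poly M z - poly r z)}"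
  have "compact U"
  proof -
    have "U = K \<inter> {z. \<mu> / 2 \<le> norm (poly M z - poly r z)}" by (auto simp: U_def)
    moreover have "closed {z. \<mu> / 2 \<le> norm (poly M z - poly r z)}"
      by (intro closed_Collect_le continuous_intros)
    ultimately show ?thesis using K(1) by (simp add: compact_Int_closed)
  qed
  have "\<exists>\<nu><\<mu>. \<forall>z\<in>U. norm (poly M z) \<le> \<nu>"
  proof (cases "U = {}")
    case True
    then show ?thesis using \<open>\<mu> > 0\<close> by auto
  next
    case False
    have "continuous_on U (\<lambda>z. norm (poly M z))" by (intro continuous_intros)
    from continuous_attains_sup[OF \<open>compact U\<close> False this]
    obtain u where u: "u \<in> U" "\<And>z. z \<in> U \<Longrightarrow> norm (poly M z) \<le> norm (poly M u)" by blast
    have "norm (poly M u) \<noteq> \<mu>"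
      using extremal[of u] u(1) \<open>\<mu> > 0\<close> by (auto simp: U_def)
    then have "norm (poly M u) < \<mu>" using M_le[of u] u(1) by (auto simp: U_def)
    then show ?thesis using u(2) by blast
  qed
  then obtain \<nu> where \<nu>: "\<nu> < \<mu>" "\<And>z. z \<in> U \<Longrightarrow> norm (poly M z) \<le> \<nu>" by blast
  have "compact (poly r ` K)"
    using K(1) by (intro compact_continuous_image continuous_intros)
  then obtain R where R: "R > 0" "\<And>z. z \<in> K \<Longrightarrow> norm (poly r z) \<le> R"
    using bounded_pos[of "poly r ` K"] compact_imp_bounded by blast
  define \<epsilon> where "\<epsilon> = min 1 ((\<mu> - \<nu>) / (2 * R))"
  have \<epsilon>: "0 < \<epsilon>" "\<epsilon> \<le> 1" using \<nu>(1) R(1) by (auto simp: \<epsilon>_def)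
  have "\<epsilon> \<le> (\<mu> - \<nu>) / (2 * R)" by (simp add: \<epsilon>_def)
  then have "\<epsilon> * R \<le> (\<mu> - \<nu>) / 2" using R(1) by (simp add: field_simps)
  then have \<epsilon>R: "\<epsilon> * R < \<mu> - \<nu>" using \<nu>(1) by simp
  have "norm (poly (M - smult (of_real \<epsilon>) r) z) < \<mu>" if "z \<in> K" for z
  proof (cases "z \<in> U")
    case True
    have "norm (poly M z - of_real \<epsilon> * poly r z) \<le> norm (poly M z) + \<epsilon> * norm (poly r z)"
      using norm_triangle_ineq4[of "poly M z" "of_real \<epsilon> * poly r z"] \<epsilon> by (simp add: norm_mult)
    also have "\<dots> \<le> \<nu> + \<epsilon> * R"
      using \<nu>(2)[OF True] R(2)[OF that] \<epsilon> by (intro add_mono mult_left_mono) auto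
    also have "\<dots> < \<mu>" using \<epsilon>R by simp
    finally show ?thesis by simp
  next
    case False
    then have close: "norm (poly M z - poly r z) < \<mu> / 2" using that by (auto simp: U_def)
    have "poly M z - of_real \<epsilon> * poly r z
        = of_real (1 - \<epsilon>) * poly M z + of_real \<epsilon> * (poly M z - poly r z)"
      by (simp add: algebra_simps)
    also have "norm \<dots> \<le> norm (of_real (1 - \<epsilon>) * poly M z)
        + norm (of_real \<epsilon> * (poly M z - poly r z))"
      by (rule norm_triangle_ineq)
    also have "\<dots> = (1 - \<epsilon>) * norm (poly M z) + \<epsilon> * norm (poly M z - poly r z)"
      using \<epsilon> by (simp only: norm_mult norm_of_real)
    also have "\<dots> \<le> (1 - \<epsilon>) * \<mu> + \<epsilon> * (\<mu> / 2)"
      using M_le[OF that] close \<epsilon> by (intro add_mono mult_left_mono) auto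
    also have "\<dots> < \<mu>" using \<epsilon> \<open>\<mu> > 0\<close> by (simp add: algebra_simps)
    finally show ?thesis by simp
  qed
  then show False using M_minimal[of \<epsilon>] by force
qed

text \<open>The centre \<open>c\<close> of a smallest disc around \<open>L\<close>. The pairs of a centre and a radius of discs that
contain \<open>L\<close> form a closed set, and only a bounded part of it competes for the least radius.\<close>

lemma Chebyshev_centre_exists:
  fixes L :: "complex set"
  assumes L: "compact L" "L \<noteq> {}"
  shows "\<exists>c \<mu>. (\<forall>w\<in>L. norm (w - c) \<le> \<mu>) \<and> (\<forall>d. \<exists>w\<in>L. \<mu> \<le> norm (w - d))"
proof -
  obtain w0 where w0: "w0 \<in> L" using L(2) by blast
  obtain R where R: "\<And>w. w \<in> L \<Longrightarrow> norm (w - w0) \<le> R"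
    using bounded_any_center[of L w0] compact_imp_bounded[OF L(1)]
    by (auto simp: dist_norm norm_minus_commute)
  define P where "P = (cball w0 R \<times> {0..R}) \<inter> (\<Inter>w\<in>L. {p. norm (w - fst p) \<le> snd p})"
  have "closed (\<Inter>w\<in>L. {p :: complex \<times> real. norm (w - fst p) \<le> snd p})"
    by (intro closed_INT ballI closed_Collect_le continuous_intros)
  then have "compact P"
    unfolding P_def by (intro compact_Int_closed compact_Times) auto
  moreover have "(w0, R) \<in> P" using R w0 R[OF w0] by (auto simp: P_def)
  moreover have "continuous_on P snd" by (intro continuous_intros)
  ultimately obtain p where p: "p \<in> P" "\<And>q. q \<in> P \<Longrightarrow> snd p \<le> snd q"
    using continuous_attains_inf[of P snd] by blast
  show ?thesis
  proof (intro exI conjI ballI allI)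
    show "norm (w - fst p) \<le> snd p" if "w \<in> L" for w using p(1) that by (auto simp: P_def)
  next
    fix d
    have "continuous_on L (\<lambda>w. norm (w - d))" by (intro continuous_intros)
    from continuous_attains_sup[OF L this]
    obtain v where v: "v \<in> L" "\<And>w. w \<in> L \<Longrightarrow> norm (w - d) \<le> norm (v - d)" by blast
    show "\<exists>w\<in>L. snd p \<le> norm (w - d)"
    proof (cases "norm (v - d) \<le> R")
      case True
      then have "(d, norm (v - d)) \<in> P"
        using v w0 order_trans[OF v(2)[OF w0] True] by (auto simp: P_def dist_norm)
      then show ?thesis using p(2) v(1) by fastforce
    next
      case False
      then show ?thesis using p(1) v(1) by (intro bexI[of _ v]) (auto simp: P_def)
    qed
  qed
qed

section \<open>Polynomials with a common saturated set\<close>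

lemma pcompose_monom:
  fixes f :: "'a :: comm_ring_1 poly"
  shows "pcompose (monom a m) f = smult a (f ^ m)"
  by (induction m) (simp_all add: monom_0 monom_Suc pcompose_pCons)

text \<open>Subtracting from \<open>g\<close> the centre \<open>c\<close> of the smallest disc around \<open>g(K)\<close> gives a polynomial \<open>G\<close> of least
sup norm on \<open>K\<close> for its leading term: a correction of lower degree averages over the fibres of \<open>g\<close> to a
constant, that is, to a mere shift of \<open>c\<close>. Averaging \<open>G\<close> over the fibres of \<open>f\<close> gives \<open>Q \<circ> f\<close>. This
has the leading term of \<open>G\<close>, because \<open>degree f\<close> divides \<open>degree g\<close>, and no larger norm on \<open>K\<close>, because the fibres
of \<open>f\<close> through points of \<open>K\<close> stay in \<open>K\<close>. By uniqueness \<open>G = Q \<circ> f\<close>, hence \<open>g = (Q + c) \<circ> f\<close>.\<close>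

lemma saturated_imp_factor:
  fixes f g :: "complex poly"
  assumes K: "compact K" "infinite K"
    and sat_f: "K = poly f -` (poly f ` K)" and sat_g: "K = poly g -` (poly g ` K)"
    and deg: "0 < degree g" "degree f dvd degree g"
  shows "\<exists>A. g = pcompose A f"
proof -
  obtain m where m: "degree g = degree f * m" using deg(2) by blast
  have f: "0 < degree f" using m deg(1) by auto
  have "compact (poly g ` K)" "poly g ` K \<noteq> {}"
    using K by (auto intro!: compact_continuous_image continuous_intros)
  from Chebyshev_centre_exists[OF this]
  obtain c \<mu> where le: "\<forall>w\<in>poly g ` K. norm (w - c) \<le> \<mu>"
    and ge: "\<forall>d. \<exists>w\<in>poly g ` K. \<mu> \<le> norm (w - d)"
    by (elim exE conjE)
  define G where "G = g - [:c:]"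
  have deg_G: "degree G = degree g" by (simp add: G_def degree_diff_const)
  have G_le: "norm (poly G z) \<le> \<mu>" if "z \<in> K" for z
    using le that by (simp add: G_def)
  have G_minimal: "\<exists>z\<in>K. \<mu> \<le> norm (poly (G + r) z)" if r: "degree r < degree G" for r
  proof (rule ccontr)
    assume "\<not> ?thesis"
    then have lt: "norm (poly (G + r) z) < \<mu>" if "z \<in> K" for z using that by force
    obtain e where e: "\<And>w. fibre_sum g r w = e"
      using fibre_sum_lower_degree_const[of r g] r deg_G by auto
    define d where "d = e / of_nat (degree g)"
    have avg: "fibre_sum g (G + r) w = of_nat (degree g) * (w - (c - d))" for w
    proof -
      have "G = pcompose [:- c, 1:] g * 1"
        by (cases g) (simp add: G_def pcompose_pCons)
      then have "fibre_sum g (G + r) w = fibre_sum g (pcompose [:- c, 1:] g * 1 + r) w"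
        by (rule arg_cong[where f = "\<lambda>p. fibre_sum g (p + r) w"])
      also have "\<dots> = (w - c) * of_nat (degree g) + e"
        using fibre_sum_const[of g 1, folded one_pCons]
        by (simp only: fibre_sum_add fibre_sum_pcompose_mult[OF deg(1)] e) simp
      finally show ?thesis using deg(1) by (simp add: d_def algebra_simps)
    qed
    obtain w where w: "w \<in> poly g ` K" "\<mu> \<le> norm (w - (c - d))" using ge by blast
    have fibre: "{x. poly g x = w} \<subseteq> K" using w(1) by (subst sat_g) auto
    have fin: "finite {x. poly g x = w}"
      using set_fibre[OF deg(1), of w] finite_set_mset by metis
    have ne: "{x. poly g x = w} \<noteq> {}" using w(1) by auto
    define \<nu> where "\<nu> = Max ((\<lambda>x. norm (poly (G + r) x)) ` {x. poly g x = w})"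
    have "\<nu> < \<mu>" unfolding \<nu>_def using fin ne fibre lt by (subst Max_less_iff) auto
    moreover have "norm (w - (c - d)) \<le> \<nu>"
    proof (rule norm_fibre_average_le[OF deg(1) avg])
      show "norm (poly (G + r) x) \<le> \<nu>" if "poly g x = w" for x
        unfolding \<nu>_def using fin that by (intro Max_ge) auto
    qed
    ultimately show False using w(2) by simp
  qed
  \<comment> \<open>\<open>G = a f\<^sup>m + p\<close> with \<open>p\<close> of lower degree: the first summand survives averaging
    unchanged, the second keeps its degree below that of \<open>G\<close>.\<close>
  define a where "a = lead_coeff G / lead_coeff f ^ m"
  define p where "p = G - smult a (f ^ m)"
  have "degree p < degree G"
  proof (rule degree_lessI)
    show "p \<noteq> 0 \<or> 0 < degree G" using deg deg_G by simp
    have fm: "degree (f ^ m) = degree G" using f by (subst degree_power_eq) (auto simp: m deg_G)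
    show "\<forall>k\<ge>degree G. coeff p k = 0"
    proof (intro allI impI)
      fix k assume k: "degree G \<le> k"
      have "lead_coeff (f ^ m) = lead_coeff f ^ m" by (rule lead_coeff_power)
      then have lc: "coeff (f ^ m) (degree G) = lead_coeff f ^ m" using fm by simp
      show "coeff p k = 0"
        using k f fm lc by (cases "k = degree G") (auto simp: p_def a_def coeff_eq_0)
    qed
  qed
  obtain q where q: "degree q * degree f \<le> degree p"
    "\<And>w. fibre_sum f p w = of_nat (degree f) * poly q w"
    using fibre_average_poly[OF f] by blast
  define Q where "Q = monom a m + q"
  have avg_G: "fibre_sum f G w = of_nat (degree f) * poly Q w" for w
  proof -
    have "fibre_sum f G w = fibre_sum f (pcompose (monom a m) f * 1 + p) w"
      by (simp add: p_def pcompose_monom)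
    also have "\<dots> = a * w ^ m * of_nat (degree f) + of_nat (degree f) * poly q w"
      using fibre_sum_const[of f 1, folded one_pCons]
      by (simp only: fibre_sum_add fibre_sum_pcompose_mult[OF f] q(2)) (simp add: poly_monom)
    finally show ?thesis by (simp add: Q_def poly_monom algebra_simps)
  qed
  have "G = pcompose Q f"
  proof (rule minimal_deviation_unique[OF K G_le _ _ G_minimal])
    show "norm (poly (pcompose Q f) z) \<le> \<mu>" if z: "z \<in> K" for z
      unfolding poly_pcompose
    proof (rule norm_fibre_average_le[OF f avg_G])
      fix x assume "poly f x = poly f z"
      then have "x \<in> K" using z by (subst sat_f) auto
      then show "norm (poly G x) \<le> \<mu>" by (rule G_le)
    qed
    have "G - pcompose Q f = p - pcompose q f"
      by (simp add: Q_def p_def pcompose_add pcompose_monom)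
    moreover have "degree (p - pcompose q f) < degree G"
      using \<open>degree p < degree G\<close> q(1)
      by (intro degree_diff_less) (auto simp: degree_pcompose)
    ultimately show "degree (G - pcompose Q f) < degree G" by simp
  qed
  then have "g = pcompose (Q + [:c:]) f" by (simp add: G_def pcompose_add algebra_simps)
  then show ?thesis by blast
qed

section \<open>The filled-in Julia set\<close>

lemma poly_mem_filled_julia_iff:
  "z \<in> filled_julia B \<longleftrightarrow> poly B z \<in> filled_julia B"
proof -
  have "range (\<lambda>n. (poly B ^^ n) z) = insert z (range (\<lambda>n. (poly B ^^ n) (poly B z)))"
    (is "?L = ?R")
  proof
    show "?L \<subseteq> ?R"
    proof
      fix y assume "y \<in> ?L"
      then obtain n where "y = (poly B ^^ n) z" by blast
      then show "y \<in> ?R" by (cases n) (auto simp: funpow_swap1)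
    qed
    have "(poly B ^^ n) (poly B z) = (poly B ^^ Suc n) z" for n
      by (simp add: funpow_swap1)
    moreover have "z = (poly B ^^ 0) z" by simp
    ultimately show "?R \<subseteq> ?L" by blast
  qed
  then show ?thesis by (simp add: filled_julia_def)
qed

text \<open>In \<open>B(z) = a + z q(z)\<close> the factor \<open>q\<close> is nonconstant, so \<open>\<bar>q(z)\<bar> \<ge> 3\<close> far out. One of the three multiples
of \<open>\<bar>z\<bar>\<close> pays for the constant \<open>a\<close>, and the other two remain.\<close>

lemma escape_radius:
  fixes B :: "complex poly"
  assumes "2 \<le> degree B"
  obtains R where "0 < R" and "\<And>z. R \<le> norm z \<Longrightarrow> 2 * norm z \<le> norm (poly B z)"
proof -
  obtain a b p where B: "B = pCons a (pCons b p)" by (metis pCons_cases)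
  have "p \<noteq> 0" using assms by (auto simp: B degree_pCons_eq_if split: if_splits)
  then obtain r where r: "\<And>z. r \<le> norm z \<Longrightarrow> 3 \<le> norm (poly (pCons b p) z)"
    using poly_infinity by blast
  show thesis
  proof (rule that)
    show "0 < max 1 (max r (norm a))" by simp
    fix z :: complex assume z: "max 1 (max r (norm a)) \<le> norm z"
    have Bz: "poly B z - a = z * poly (pCons b p) z" unfolding B by simp
    have "norm z * 3 \<le> norm z * norm (poly (pCons b p) z)"
      using r[of z] z by (intro mult_left_mono) auto
    also have "\<dots> = norm (poly B z - a)" unfolding Bz by (simp only: norm_mult)
    also have "\<dots> \<le> norm (poly B z) + norm a" by (rule norm_triangle_ineq4)
    finally show "2 * norm z \<le> norm (poly B z)" using z by simp
  qed
qed

text \<open>An orbit that leaves the disc of the escape radius doubles its modulus at every step. The set of points whose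
orbits never leave the disc is therefore \<open>K(B)\<close>, and it is an intersection of closed sets.\<close>

lemma compact_filled_julia:
  assumes "2 \<le> degree B"
  shows "compact (filled_julia B)"
proof -
  obtain R where R: "0 < R" "\<And>z. R \<le> norm z \<Longrightarrow> 2 * norm z \<le> norm (poly B z)"
    using escape_radius[OF assms] by blast
  have escape: "z \<notin> filled_julia B" if z: "R < norm z" for z
  proof
    assume "z \<in> filled_julia B"
    then obtain C where C: "\<And>n. norm ((poly B ^^ n) z) \<le> C"
      by (auto simp: filled_julia_def bounded_iff)
    have grow: "2 ^ n * norm z \<le> norm ((poly B ^^ n) z)" for n
    proof (induction n)
      case (Suc n)
      have "1 * norm z \<le> 2 ^ n * norm z" by (intro mult_right_mono) auto
      then have "R \<le> norm ((poly B ^^ n) z)" using Suc z by simp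
      then show ?case using R(2)[of "(poly B ^^ n) z"] Suc by simp
    qed simp
    obtain n where "C / norm z < 2 ^ n" using real_arch_pow[of 2 "C / norm z"] by auto
    moreover have "0 < norm z" using z R(1) by linarith
    ultimately have "C < 2 ^ n * norm z" by (simp only: pos_divide_less_eq)
    then show False using grow[of n] C[of n] by simp
  qed
  have iter: "(poly B ^^ n) z \<in> filled_julia B" if "z \<in> filled_julia B" for n z
    using that by (induction n) (auto simp flip: poly_mem_filled_julia_iff)
  have "filled_julia B = (\<Inter>n. {z. norm ((poly B ^^ n) z) \<le> R})"
  proof
    show "filled_julia B \<subseteq> (\<Inter>n. {z. norm ((poly B ^^ n) z) \<le> R})"
      using iter escape not_le by blast
    show "(\<Inter>n. {z. norm ((poly B ^^ n) z) \<le> R}) \<subseteq> filled_julia B"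
      by (auto simp: filled_julia_def bounded_iff)
  qed
  moreover have "continuous_on UNIV (poly B ^^ n)" for n
    by (induction n) (auto intro!: continuous_intros)
  then have "closed (\<Inter>n. {z. norm ((poly B ^^ n) z) \<le> R})"
    by (intro closed_INT ballI closed_Collect_le continuous_intros)
  moreover have "filled_julia B \<subseteq> cball 0 R" using escape by force
  ultimately show ?thesis
    by (metis bounded_cball bounded_subset compact_eq_bounded_closed)
qed

text \<open>If \<open>K(B)\<close> were finite, \<open>B\<close> would permute it, because \<open>B\<close> maps \<open>K(B)\<close> onto itself. A fixed point \<open>a\<close> would
then be the only preimage of itself, so that \<open>B(z) = a + c (z - a)\<^sup>d\<close>. Such a map sends a small
disc around \<open>a\<close> into itself, and this disc would lie in \<open>K(B)\<close>.\<close>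

lemma infinite_filled_julia:
  assumes "2 \<le> degree B"
  shows "infinite (filled_julia B)"
proof
  let ?K = "filled_julia B"
  assume fin: "finite ?K"
  have surj: "\<exists>z. poly B z = w" for w
    using poly_surj[of B] assms by simp
  have "?K \<subseteq> poly B ` ?K"
  proof
    fix w assume "w \<in> ?K"
    moreover obtain z where "poly B z = w" using surj by blast
    ultimately show "w \<in> poly B ` ?K" using poly_mem_filled_julia_iff by blast
  qed
  moreover have "poly B ` ?K \<subseteq> ?K" using poly_mem_filled_julia_iff by blast
  ultimately have inj: "inj_on (poly B) ?K" using fin by (intro finite_surj_inj) auto
  have "degree (B - [:0, 1:]) = degree B"
    using degree_add_eq_left[of "- [:0, 1:]" B] assms
    by (simp only: diff_conv_add_uminus degree_minus) simp
  then have "\<not> constant (poly (B - [:0, 1:]))" using assms by (simp add: constant_degree)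
  then obtain a where "poly (B - [:0, 1:]) a = 0" using fundamental_theorem_of_algebra by blast
  then have a: "poly B a = a" by simp
  have "(poly B ^^ n) a = a" for n by (induction n) (auto simp: a)
  then have aK: "a \<in> ?K" by (simp add: filled_julia_def)
  define F where "F = B - [:a:]"
  define d where "d = order a F"
  have "degree F = degree B" by (simp add: F_def degree_diff_const)
  have "F \<noteq> 0" using \<open>degree F = degree B\<close> assms by auto
  have roots: "{z. poly F z = 0} = {a}"
  proof -
    have "z = a" if "poly B z = a" for z
    proof -
      have "z \<in> ?K" using that aK poly_mem_filled_julia_iff by metis
      then show ?thesis using inj aK that a by (metis inj_onD)
    qed
    then show ?thesis using a by (auto simp: F_def)
  qed
  have F: "F = smult (lead_coeff F) ([:-a, 1:] ^ d)"
    using complex_poly_decompose[of F] by (simp add: roots d_def)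
  have "degree F = d"
    by (subst F) (use \<open>F \<noteq> 0\<close> in \<open>simp add: degree_power_eq\<close>)
  then have d: "2 \<le> d" using assms \<open>degree F = degree B\<close> by simp
  define k where "k = norm (lead_coeff F)"
  have dist: "dist a (poly B z) = k * dist a z ^ d" for z
  proof -
    have "poly B z - a = poly F z" by (simp add: F_def)
    also have "\<dots> = lead_coeff F * (z - a) ^ d" by (subst F) (simp add: poly_power)
    finally have "norm (poly B z - a) = k * norm (z - a) ^ d"
      by (simp add: k_def norm_mult norm_power)
    then show ?thesis by (simp add: dist_norm norm_minus_commute)
  qed
  have "k > 0" using \<open>F \<noteq> 0\<close> by (simp add: k_def)
  define \<delta> where "\<delta> = min 1 (1 / k)"
  have \<delta>: "0 < \<delta>" "\<delta> \<le> 1" "k * \<delta> \<le> 1" using \<open>k > 0\<close> by (auto simp: \<delta>_def min_def field_simps)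
  have step: "poly B z \<in> cball a \<delta>" if "z \<in> cball a \<delta>" for z
  proof -
    have "k * dist a z ^ d \<le> k * \<delta> ^ d"
      using that \<open>k > 0\<close> by (intro mult_left_mono power_mono) auto
    also have "\<dots> \<le> k * \<delta> ^ 2"
      using \<delta> d \<open>k > 0\<close> by (intro mult_left_mono power_decreasing) auto
    also have "\<dots> = (k * \<delta>) * \<delta>" by (simp add: power2_eq_square)
    also have "\<dots> \<le> 1 * \<delta>" using \<delta> by (intro mult_right_mono) auto
    finally show ?thesis by (simp add: dist)
  qed
  have "cball a \<delta> \<subseteq> ?K"
  proof
    fix z assume "z \<in> cball a \<delta>"
    then have "(poly B ^^ n) z \<in> cball a \<delta>" for n by (induction n) (use step in auto)
    then have "range (\<lambda>n. (poly B ^^ n) z) \<subseteq> cball a \<delta>" by blast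
    then show "z \<in> ?K"
      unfolding filled_julia_def using bounded_cball bounded_subset by blast
  qed
  then have "finite (ball a \<delta>)"
    by (rule finite_subset[OF subset_trans[OF ball_subset_cball] fin])
  then show False using uncountable_ball[OF \<delta>(1), of a] by (simp add: countable_finite)
qed

text \<open>If \<open>X\<close> takes the same value at \<open>z\<close> and \<open>w\<close>, the semiconjugacy makes \<open>X\<close> agree along their whole orbits.
Nonconstant polynomials map bounded sets to bounded sets and unbounded sets to unbounded sets, so the
two orbits are bounded or unbounded together.\<close>

lemma semiconjugacy_imp_saturated:
  assumes X: "0 < degree X" and semi: "pcompose A X = pcompose X B"
  shows "filled_julia B = poly X -` (poly X ` filled_julia B)"
proof
  show "poly X -` (poly X ` filled_julia B) \<subseteq> filled_julia B"
  proof
    fix z assume "z \<in> poly X -` (poly X ` filled_julia B)"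
    then obtain w where w: "w \<in> filled_julia B" "poly X z = poly X w" by auto
    have semi_at: "poly X (poly B u) = poly A (poly X u)" for u
      using semi by (metis poly_pcompose)
    then have iter: "poly X ((poly B ^^ n) u) = (poly A ^^ n) (poly X u)" for n u
      by (induction n) (simp_all add: semi_at)
    have "bounded (poly X ` range (\<lambda>n. (poly B ^^ n) w))"
    proof (rule bounded_subset)
      show "bounded (poly X ` closure (range (\<lambda>n. (poly B ^^ n) w)))"
        using w(1) unfolding filled_julia_def
        by (intro compact_imp_bounded compact_continuous_image continuous_intros) simp
    qed (intro image_mono closure_subset)
    then obtain C where C: "\<And>n. norm (poly X ((poly B ^^ n) w)) \<le> C"
      by (auto simp: bounded_iff)
    obtain a p where Xp: "X = pCons a p" by (metis pCons_cases)
    then have "p \<noteq> 0" using X by auto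
    then obtain r where r: "\<And>u. r \<le> norm u \<Longrightarrow> C + 1 \<le> norm (poly X u)"
      using poly_infinity Xp by blast
    have "norm ((poly B ^^ n) z) \<le> r" for n
      using r[of "(poly B ^^ n) z"] C[of n] w(2) by (force simp: iter)
    then show "z \<in> filled_julia B" by (auto simp: filled_julia_def bounded_iff)
  qed
qed blast

section \<open>Semiconjugacies and fibres\<close>

text \<open>Both \<open>X\<close> and \<open>X \<circ> B\<close> have \<open>K(B)\<close> as a union of fibres, since \<open>K(B)\<close> is its own preimage under \<open>B\<close>. The
degree of \<open>X\<close> divides that of \<open>X \<circ> B\<close>, so \<open>X \<circ> B\<close> factors through \<open>X\<close>.\<close>

lemma saturated_imp_semiconj:
  assumes B: "2 \<le> degree B" and X: "2 \<le> degree X"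
    and sat: "filled_julia B = poly X -` (poly X ` filled_julia B)"
  shows "\<exists>A. pcompose A X = pcompose X B"
proof -
  let ?K = "filled_julia B"
  have "z \<in> ?K" if "w \<in> ?K" "poly X (poly B z) = poly X (poly B w)" for z w
  proof -
    have "poly B w \<in> ?K" using that(1) poly_mem_filled_julia_iff by blast
    then have "poly B z \<in> ?K" using that(2) by (subst sat) auto
    then show ?thesis using poly_mem_filled_julia_iff by blast
  qed
  then have "?K = poly (pcompose X B) -` (poly (pcompose X B) ` ?K)"
    by (auto simp: poly_pcompose)
  then have "\<exists>A. pcompose X B = pcompose A X"
    using compact_filled_julia[OF B] infinite_filled_julia[OF B] sat B X
    by (intro saturated_imp_factor) (auto simp: degree_pcompose)
  then show ?thesis by metis
qed

theorem corollary3p3: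
  "(\<forall>B X :: complex poly. degree B \<ge> 2 \<longrightarrow> degree X \<ge> 2 \<longrightarrow>
      (X \<in> semiconj_set B \<longleftrightarrow>
       filled_julia B = poly X -` (poly X ` filled_julia B))) \<and>
   (\<forall>B1 B2 :: complex poly. degree B1 \<ge> 2 \<longrightarrow> degree B2 \<ge> 2 \<longrightarrow>
      filled_julia B1 = filled_julia B2 \<longrightarrow> semiconj_set B1 = semiconj_set B2)"
proof -
  have iff: "X \<in> semiconj_set B \<longleftrightarrow> 2 \<le> degree X \<and>
      filled_julia B = poly X -` (poly X ` filled_julia B)"
    if "2 \<le> degree B" for B X :: "complex poly"
  proof
    assume "X \<in> semiconj_set B"
    then obtain A where "2 \<le> degree X" "pcompose A X = pcompose X B"
      by (auto simp: semiconj_set_def)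
    then show "2 \<le> degree X \<and> filled_julia B = poly X -` (poly X ` filled_julia B)"
      using semiconjugacy_imp_saturated[of X A B] by linarith
  next
    assume "2 \<le> degree X \<and> filled_julia B = poly X -` (poly X ` filled_julia B)"
    then show "X \<in> semiconj_set B"
      using saturated_imp_semiconj[OF that, of X] unfolding semiconj_set_def by blast
  qed
  have eq: "semiconj_set B1 = semiconj_set B2"
    if "2 \<le> degree B1" "2 \<le> degree B2" "filled_julia B1 = filled_julia B2"
    for B1 B2 :: "complex poly"
    using iff[OF that(1)] iff[OF that(2)] that(3) by (intro set_eqI) metis
  show ?thesis
  proof (intro conjI allI impI)
    show "X \<in> semiconj_set B \<longleftrightarrow> filled_julia B = poly X -` (poly X ` filled_julia B)"
      if "2 \<le> degree B" "2 \<le> degree X" for B X :: "complex poly"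
      using iff[OF that(1), of X] that(2) by blast
  qed (rule eq)
qed

end
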